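(* Let $g(x)=\sum_{j=1}^p g_j(x_j)$ with each $g_j:\mathbb{R}\to\mathbb{R}\cup\{+\infty\}$ proper, closed and convex, and let $x^\star\in\operatorname{dom}(g)$. If for every $j\in\mathcal{S}_{x^\star}$, $g_j$ is $\mathcal{C}^2$ on a neighbourhood of $x^\star_j$, then $g$ is partly smooth at $x^\star$ relative to the affine set $x^\star+T_{x^\star}$.
   Context: Generalized support: $\mathcal{S}_x=\{j\in[p]:\partial g_j(x_j)\text{ is a singleton}\}$. Model subspace: $T_x=\{u\in\mathbb{R}^p:u_j=0\ \forall j\notin\mathcal{S}_x\}$. A proper closed convex $g$ is partly smooth at $x$ relative to a set $\mathcal{M}$ if there is a neighbourhood $\mathcal{U}$ of $x$ such that: (smoothness) $\mathcal{M}\cap\mathcal{U}$ is a $\mathcal{C}^2$ manifold and $g$ restricted to $\mathcal{M}\cap\mathcal{U}$ is $\mathcal{C}^2$; (sharpness) the tangent space of $\mathcal{M}$ at $x$ equals $\operatorname{Lin}(\partial g(x))^\perp$, where $\operatorname{Lin}(\partial g(x))=\operatorname{aff}(\partial g(x))-e_x$ with $e_x$ the minimal-norm element of $\operatorname{aff}(\partial g(x))$; (continuity) the set-valued map $\partial g$ is continuous at $x$ relative to $\mathcal{M}$. *)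

theory Defs
  imports "HOL-Analysis.Analysis"
begin

text \<open>Functions with values in R \<union> {+\<infinity>} are modelled as functions into ereal that never take -\<infinity>.\<close>

definition epigraph1 :: "(real \<Rightarrow> ereal) \<Rightarrow> (real \<times> real) set" where
  "epigraph1 f = {(t, r). f t \<le> ereal r}"

definition proper_fun :: "('a \<Rightarrow> ereal) \<Rightarrow> bool" where
  "proper_fun f \<longleftrightarrow> (\<forall>x. f x \<noteq> -\<infinity>) \<and> (\<exists>x. f x \<noteq> \<infinity>)"

definition closed_fun1 :: "(real \<Rightarrow> ereal) \<Rightarrow> bool" where
  "closed_fun1 f \<longleftrightarrow> closed (epigraph1 f)"

definition convex_fun1 :: "(real \<Rightarrow> ereal) \<Rightarrow> bool" where
  "convex_fun1 f \<longleftrightarrow> convex (epigraph1 f)"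

definition edom :: "('a \<Rightarrow> ereal) \<Rightarrow> 'a set" where
  "edom f = {x. f x < \<infinity>}"

definition subdiff :: "('a::real_inner \<Rightarrow> ereal) \<Rightarrow> 'a \<Rightarrow> 'a set" where
  "subdiff f x = {v. f x < \<infinity> \<and> (\<forall>y. f x + ereal (v \<bullet> (y - x)) \<le> f y)}"

definition sep_sum :: "('n::finite \<Rightarrow> real \<Rightarrow> ereal) \<Rightarrow> real^'n \<Rightarrow> ereal" where
  "sep_sum G x = (\<Sum>j\<in>UNIV. G j (x $ j))"

definition gen_support :: "('n::finite \<Rightarrow> real \<Rightarrow> ereal) \<Rightarrow> real^'n \<Rightarrow> 'n set" where
  "gen_support G x = {j. \<exists>v. subdiff (G j) (x $ j) = {v}}"

definition model_subspace :: "('n::finite \<Rightarrow> real \<Rightarrow> ereal) \<Rightarrow> real^'n \<Rightarrow> (real^'n) set" where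
  "model_subspace G x = {u. \<forall>j. j \<notin> gen_support G x \<longrightarrow> u $ j = 0}"

definition C2_on :: "'a::real_normed_vector set \<Rightarrow> ('a \<Rightarrow> 'b::real_normed_vector) \<Rightarrow> bool" where
  "C2_on S f \<longleftrightarrow> (\<exists>f' f''.
      (\<forall>x\<in>S. (f has_derivative blinfun_apply (f' x)) (at x)) \<and>
      (\<forall>x\<in>S. (f' has_derivative blinfun_apply (f'' x)) (at x)) \<and>
      continuous_on S f'')"

definition C2_near :: "('a::real_normed_vector \<Rightarrow> ereal) \<Rightarrow> 'a \<Rightarrow> bool" where
  "C2_near f x \<longleftrightarrow> (\<exists>V h. open V \<and> x \<in> V \<and> C2_on V h \<and> (\<forall>z\<in>V. f z = ereal (h z)))"

definition C2_manifold :: "('a::euclidean_space) set \<Rightarrow> bool" where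
  "C2_manifold N \<longleftrightarrow> (\<forall>y\<in>N. \<exists>V W (\<phi>::'a \<Rightarrow> 'a) \<psi> L.
      open V \<and> y \<in> V \<and> open W \<and> subspace L \<and> C2_on V \<phi> \<and> C2_on W \<psi> \<and>
      \<phi> ` V = W \<and> (\<forall>z\<in>V. \<psi> (\<phi> z) = z) \<and> \<phi> ` (N \<inter> V) = L \<inter> W)"

definition C2_restricted :: "('a::real_normed_vector \<Rightarrow> ereal) \<Rightarrow> 'a set \<Rightarrow> bool" where
  "C2_restricted g N \<longleftrightarrow> (\<forall>y\<in>N. \<exists>V h. open V \<and> y \<in> V \<and> C2_on V h \<and>
      (\<forall>z\<in>N \<inter> V. g z = ereal (h z)))"

definition tangent_space :: "('a::real_normed_vector) set \<Rightarrow> 'a \<Rightarrow> 'a set" where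
  "tangent_space M x = {v. \<exists>(\<gamma>::real \<Rightarrow> 'a) e. e > 0 \<and> \<gamma> 0 = x \<and>
      (\<forall>t\<in>{-e<..<e}. \<gamma> t \<in> M) \<and> (\<gamma> has_vector_derivative v) (at 0)}"

definition min_norm_elem :: "'a::real_normed_vector set \<Rightarrow> 'a" where
  "min_norm_elem A = (THE e. e \<in> A \<and> (\<forall>a\<in>A. norm e \<le> norm a))"

definition Lin :: "'a::real_normed_vector set \<Rightarrow> 'a set" where
  "Lin C = (\<lambda>a. a - min_norm_elem (affine hull C)) ` (affine hull C)"

text \<open>Painleve-Kuratowski continuity of a set-valued map F at x relative to M.\<close>
definition pk_continuous_rel :: "('a::metric_space \<Rightarrow> 'b::metric_space set) \<Rightarrow> 'a \<Rightarrow> 'a set \<Rightarrow> bool" where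
  "pk_continuous_rel F x M \<longleftrightarrow>
     (\<forall>ys vs v. (\<forall>k. ys k \<in> M) \<and> ys \<longlonglongrightarrow> x \<and> (\<forall>k. vs k \<in> F (ys k)) \<and> vs \<longlonglongrightarrow> v
         \<longrightarrow> v \<in> F x) \<and>
     (\<forall>v\<in>F x. \<forall>ys. (\<forall>k. ys k \<in> M) \<and> ys \<longlonglongrightarrow> x \<longrightarrow>
         (\<exists>vs. (\<forall>\<^sub>F k in sequentially. vs k \<in> F (ys k)) \<and> vs \<longlonglongrightarrow> v))"

definition partly_smooth :: "('a::euclidean_space \<Rightarrow> ereal) \<Rightarrow> 'a \<Rightarrow> 'a set \<Rightarrow> bool" where
  "partly_smooth g x M \<longleftrightarrow>
     (\<exists>U. open U \<and> x \<in> U \<and> C2_manifold (M \<inter> U) \<and> C2_restricted g (M \<inter> U)) \<and>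
     tangent_space M x = orthogonal_comp (Lin (subdiff g x)) \<and>
     pk_continuous_rel (subdiff g) x M"

end

theory Submission
  imports Defs
begin

(* The subdifferential of a separable sum is the product of the one-dimensional
   subdifferentials. On the generalized support S each factor is a singleton and off S it
   contains two points, so the affine hull of the product frees exactly the coordinates
   outside S; hence Lin of the subdifferential is the coordinate subspace on S, whose
   orthogonal complement T is the tangent space of the affine set x + T.
   On x + T only the coordinates in S move, and there every g_j is C^2, so g restricted to
   x + T is C^2. Continuity of the subdifferential along x + T is checked coordinatewise:
   outside S the coordinates are frozen, on S the derivatives g_j' are subgradients depending
   continuously on the point, and outer semicontinuity is the closedness of the graph of the
   subdifferential of a closed convex function. *)

lemma C2_on_subset: "C2_on S f \<Longrightarrow> T \<subseteq> S \<Longrightarrow> C2_on T f"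
  unfolding C2_on_def by (meson continuous_on_subset subsetD)

lemma C2_on_const: "C2_on S (\<lambda>x. c)"
  unfolding C2_on_def
  by (intro exI[of _ "\<lambda>_. 0"])
     (auto intro: has_derivative_eq_rhs[OF has_derivative_const] simp: fun_eq_iff)

lemma C2_on_id: "C2_on S (\<lambda>x. x)"
  unfolding C2_on_def
  by (intro exI[of _ "\<lambda>_. id_blinfun"] exI[of _ "\<lambda>_. 0"])
     (auto intro: has_derivative_eq_rhs[OF has_derivative_ident]
        has_derivative_eq_rhs[OF has_derivative_const] simp: fun_eq_iff)

lemma C2_on_add:
  assumes "C2_on S f" "C2_on S g"
  shows "C2_on S (\<lambda>x. f x + g x)"
proof -
  obtain f' f'' g' g'' where
    f: "\<forall>x\<in>S. (f has_derivative blinfun_apply (f' x)) (at x)"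
       "\<forall>x\<in>S. (f' has_derivative blinfun_apply (f'' x)) (at x)" "continuous_on S f''"
    and g: "\<forall>x\<in>S. (g has_derivative blinfun_apply (g' x)) (at x)"
       "\<forall>x\<in>S. (g' has_derivative blinfun_apply (g'' x)) (at x)" "continuous_on S g''"
    using assms unfolding C2_on_def by metis
  show ?thesis
    unfolding C2_on_def
    using f g
    by (intro exI[of _ "\<lambda>x. f' x + g' x"] exI[of _ "\<lambda>x. f'' x + g'' x"])
       (auto intro!: has_derivative_eq_rhs[OF has_derivative_add] continuous_on_add
             simp: fun_eq_iff blinfun.add_left)
qed

lemma C2_on_sum:
  "finite I \<Longrightarrow> (\<And>i. i \<in> I \<Longrightarrow> C2_on S (f i)) \<Longrightarrow> C2_on S (\<lambda>x. \<Sum>i\<in>I. f i x)"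
  by (induction I rule: finite_induct) (auto intro: C2_on_const C2_on_add)

lemma C2_on_compose_blinfun:
  fixes L :: "'a::real_normed_vector \<Rightarrow>\<^sub>L 'b::real_normed_vector"
  assumes "C2_on A h"
  shows "C2_on (L -` A) (\<lambda>z. h (L z))"
proof -
  obtain h' h'' where
    h: "\<forall>x\<in>A. (h has_derivative blinfun_apply (h' x)) (at x)"
       "\<forall>x\<in>A. (h' has_derivative blinfun_apply (h'' x)) (at x)" "continuous_on A h''"
    using assms unfolding C2_on_def by metis
  define R :: "('b \<Rightarrow>\<^sub>L 'c) \<Rightarrow>\<^sub>L ('a \<Rightarrow>\<^sub>L 'c)" where "R = Blinfun (\<lambda>a. a o\<^sub>L L)"
  have R: "blinfun_apply R = (\<lambda>a. a o\<^sub>L L)"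
    unfolding R_def
    by (intro bounded_linear_Blinfun_apply
        bounded_bilinear.bounded_linear_left[OF bounded_bilinear_blinfun_compose])
  have L: "(blinfun_apply L has_derivative blinfun_apply L) (at x)" for x
    by (rule blinfun.bounded_linear_right[THEN bounded_linear_imp_has_derivative])
  have compose: "blinfun_apply (a o\<^sub>L b) = (\<lambda>d. a (b d))" for a b
    by (simp add: fun_eq_iff)
  show ?thesis
    unfolding C2_on_def
  proof (intro exI conjI ballI)
    fix x assume x: "x \<in> L -` A"
    show "((\<lambda>z. h (L z)) has_derivative blinfun_apply (h' (L x) o\<^sub>L L)) (at x)"
      using diff_chain_at[OF L h(1)[rule_format, of "L x"]] x by (simp add: o_def compose)
    have "((\<lambda>z. R (h' (L z))) has_derivative (\<lambda>d. R (h'' (L x) (L d)))) (at x)"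
      using diff_chain_at[OF diff_chain_at[OF L h(2)[rule_format, of "L x"]]
          blinfun.bounded_linear_right[THEN bounded_linear_imp_has_derivative]] x
      by (simp add: o_def)
    then show "((\<lambda>z. h' (L z) o\<^sub>L L) has_derivative blinfun_apply (R o\<^sub>L h'' (L x) o\<^sub>L L)) (at x)"
      by (simp add: R compose)
  next
    have "continuous_on (L -` A) (\<lambda>x. h'' (L x))"
      by (rule continuous_on_compose2[OF h(3)]) (auto intro: continuous_intros)
    then show "continuous_on (L -` A) (\<lambda>x. R o\<^sub>L h'' (L x) o\<^sub>L L)"
      by (intro continuous_intros)
  qed
qed

lemma C2_on_vec_nth:
  fixes h :: "'a::real_normed_vector \<Rightarrow> 'b::real_normed_vector"
  assumes "C2_on V h"
  shows "C2_on ((\<lambda>z::'a^'n. z $ j) -` V) (\<lambda>z. h (z $ j))"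
proof -
  have "blinfun_apply (Blinfun (\<lambda>z::'a^'n. z $ j)) = (\<lambda>z. z $ j)"
    by (rule bounded_linear_Blinfun_apply[OF bounded_linear_vec_nth])
  then show ?thesis
    using C2_on_compose_blinfun[OF assms, of "Blinfun (\<lambda>z::'a^'n. z $ j)"] by simp
qed

lemma proper_fun_finite:
  assumes "proper_fun f" "x \<in> edom f"
  shows "f x = ereal (real_of_ereal (f x))"
  using assms unfolding proper_fun_def edom_def by (cases "f x") auto

lemma edom_sep_sum:
  assumes "\<And>j. proper_fun (G j)"
  shows "x \<in> edom (sep_sum G) \<longleftrightarrow> (\<forall>j. x $ j \<in> edom (G j))"
  using assms unfolding edom_def sep_sum_def proper_fun_def
  by (auto simp: sum_Pinfty less_top[symmetric])

lemma sep_sum_update: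
  "sep_sum G (\<chi> i. if i = j then t else x $ i) = G j t + (\<Sum>i\<in>-{j}. G i (x $ i))"
  unfolding sep_sum_def by (simp add: sum.remove[of UNIV j] Compl_eq_Diff_UNIV)

lemma subdiff_sep_sum_component:
  fixes G :: "'n::finite \<Rightarrow> real \<Rightarrow> ereal"
  assumes pr: "\<And>j. proper_fun (G j)" and v: "v \<in> subdiff (sep_sum G) x"
  shows "v $ j \<in> subdiff (G j) (x $ j)"
proof -
  define a where "a i = real_of_ereal (G i (x $ i))" for i
  have "x \<in> edom (sep_sum G)" using v unfolding subdiff_def edom_def by blast
  then have fin: "G i (x $ i) = ereal (a i)" for i
    unfolding a_def using edom_sep_sum[of G x] pr proper_fun_finite[OF pr] by blast
  define r where "r = (\<Sum>i\<in>-{j}. a i)"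
  define y where "y t = (\<chi> i. if i = j then t else x $ i)" for t
  have gy: "sep_sum G (y t) = G j t + ereal r" for t
    unfolding y_def r_def sep_sum_update by (simp add: fin)
  have "y (x $ j) = x" by (simp add: y_def vec_eq_iff)
  then have gx: "sep_sum G x = ereal (a j + r)" using gy[of "x $ j"] by (simp add: fin)
  have vy: "v \<bullet> (y t - x) = v $ j * (t - x $ j)" for t
    by (simp add: inner_vec_def y_def if_distrib[of "\<lambda>a. a - _"] if_distrib[of "(*) _"] sum.delta'
        cong: if_cong)
  have "ereal (a j + v $ j * (t - x $ j)) \<le> G j t" for t
  proof -
    have "sep_sum G x + ereal (v \<bullet> (y t - x)) \<le> sep_sum G (y t)"
      using v unfolding subdiff_def by blast
    then have "ereal (a j + r) + ereal (v $ j * (t - x $ j)) \<le> G j t + ereal r"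
      unfolding gx gy vy .
    then show ?thesis
      using pr[of j] unfolding proper_fun_def by (cases "G j t") auto
  qed
  then show ?thesis unfolding subdiff_def inner_real_def by (simp add: fin)
qed

lemma subdiff_sep_sum_intro:
  fixes G :: "'n::finite \<Rightarrow> real \<Rightarrow> ereal"
  assumes pr: "\<And>j. proper_fun (G j)" and v: "\<And>j. v $ j \<in> subdiff (G j) (x $ j)"
  shows "v \<in> subdiff (sep_sum G) x"
proof -
  define a where "a j = real_of_ereal (G j (x $ j))" for j
  have fin: "G j (x $ j) = ereal (a j)" for j
    unfolding a_def using v[of j] pr[of j] unfolding subdiff_def proper_fun_def
    by (cases "G j (x $ j)") auto
  have gx: "sep_sum G x = ereal (\<Sum>j\<in>UNIV. a j)"
    unfolding sep_sum_def by (simp add: fin)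
  show ?thesis
    unfolding subdiff_def
  proof (intro CollectI conjI allI)
    show "sep_sum G x < \<infinity>" using gx by simp
    fix y
    have "ereal (a j + v $ j * (y $ j - x $ j)) \<le> G j (y $ j)" for j
      using v unfolding subdiff_def inner_real_def by (simp add: fin)
    then have "(\<Sum>j\<in>UNIV. ereal (a j + v $ j * (y $ j - x $ j))) \<le> sep_sum G y"
      unfolding sep_sum_def by (intro sum_mono)
    moreover have "v \<bullet> (y - x) = (\<Sum>j\<in>UNIV. v $ j * (y $ j - x $ j))"
      by (simp add: inner_vec_def)
    ultimately show "sep_sum G x + ereal (v \<bullet> (y - x)) \<le> sep_sum G y"
      using gx by (simp add: sum.distrib)
  qed
qed

lemma subdiff_sep_sum:
  fixes G :: "'n::finite \<Rightarrow> real \<Rightarrow> ereal"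
  assumes "\<And>j. proper_fun (G j)"
  shows "subdiff (sep_sum G) x = {v. \<forall>j. v $ j \<in> subdiff (G j) (x $ j)}"
  using subdiff_sep_sum_component[of G] subdiff_sep_sum_intro[of G] assms by blast

lemma blinfun_has_field_derivative:
  fixes D :: "real \<Rightarrow>\<^sub>L real"
  assumes "(h has_derivative blinfun_apply D) F"
  shows "(h has_field_derivative D 1) F"
proof -
  have "blinfun_apply D = (\<lambda>t. D 1 * t)"
    by (metis blinfun.scaleR_right mult.commute mult.right_neutral real_scaleR_def)
  then show ?thesis using assms unfolding has_field_derivative_def by simp
qed

lemma subdiff_closed_graph:
  fixes f :: "real \<Rightarrow> ereal"
  assumes cl: "closed_fun1 f" and pr: "proper_fun f" and fx: "f x < \<infinity>"
    and ys: "ys \<longlonglongrightarrow> x" and vs: "vs \<longlonglongrightarrow> v" and sub: "\<And>k. vs k \<in> subdiff f (ys k)"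
  shows "v \<in> subdiff f x"
  unfolding subdiff_def inner_real_def
proof (intro CollectI conjI allI)
  show "f x < \<infinity>" by fact
  fix y
  show "f x + ereal (v * (y - x)) \<le> f y"
  proof (cases "f y")
    case PInf then show ?thesis by simp
  next
    case MInf then show ?thesis using pr unfolding proper_fun_def by auto
  next
    case (real r)
    have epi: "(ys k, r - vs k * (y - ys k)) \<in> epigraph1 f" for k
    proof -
      have "f (ys k) + ereal (vs k * (y - ys k)) \<le> f y"
        using sub[of k] unfolding subdiff_def by auto
      moreover have "f (ys k) \<noteq> -\<infinity>" using pr unfolding proper_fun_def by auto
      ultimately show ?thesis using real unfolding epigraph1_def by (cases "f (ys k)") auto
    qed
    have "(\<lambda>k. (ys k, r - vs k * (y - ys k))) \<longlonglongrightarrow> (x, r - v * (y - x))"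
      by (intro tendsto_intros ys vs)
    then have "(x, r - v * (y - x)) \<in> epigraph1 f"
      using cl epi unfolding closed_fun1_def by (rule closed_sequentially[rotated -1])
    then show ?thesis
      using real fx pr unfolding epigraph1_def proper_fun_def by (cases "f x") auto
  qed
qed

lemma convex_fun1_chord:
  assumes "convex_fun1 f" "f a \<le> ereal p" "f b \<le> ereal q" "0 \<le> t" "t \<le> 1"
  shows "f (a + t * (b - a)) \<le> ereal (p + t * (q - p))"
proof -
  have "(1 - t) *\<^sub>R (a, p) + t *\<^sub>R (b, q) \<in> epigraph1 f"
    using assms unfolding convex_fun1_def epigraph1_def by (intro convexD) auto
  then show ?thesis unfolding epigraph1_def by (simp add: algebra_simps)
qed

lemma has_field_derivative_in_subdiff:
  fixes f :: "real \<Rightarrow> ereal"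
  assumes cv: "convex_fun1 f" and pr: "proper_fun f" and V: "open V" "y \<in> V"
    and fh: "\<And>z. z \<in> V \<Longrightarrow> f z = ereal (h z)"
    and d: "(h has_field_derivative d) (at y)"
  shows "d \<in> subdiff f y"
  unfolding subdiff_def inner_real_def
proof (intro CollectI conjI allI)
  show "f y < \<infinity>" using fh V by simp
  fix z
  show "f y + ereal (d * (z - y)) \<le> f z"
  proof (cases "f z")
    case PInf then show ?thesis by simp
  next
    case MInf then show ?thesis using pr unfolding proper_fun_def by auto
  next
    case (real r)
    have chord: "f (y + t * (z - y)) \<le> ereal (h y + t * (r - h y))" if "0 \<le> t" "t \<le> 1" for t
      using convex_fun1_chord[OF cv _ _ that, of y "h y" z r] fh V real by simp
    define q where "q t = h (y + t * (z - y))" for t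
    have "((\<lambda>t. y + t * (z - y)) has_field_derivative z - y) (at 0)"
      by (auto intro!: derivative_eq_intros)
    from DERIV_chain2[OF _ this, of h d] have "(q has_field_derivative d * (z - y)) (at 0)"
      unfolding q_def using d by simp
    then have slope: "((\<lambda>t. (q t - q 0) / t) \<longlongrightarrow> d * (z - y)) (at_right 0)"
      unfolding has_field_derivative_iff by (auto intro: tendsto_mono at_le)
    have "\<forall>\<^sub>F t in at 0. y + t * (z - y) \<in> V"
    proof -
      have "((\<lambda>t. y + t * (z - y)) \<longlongrightarrow> y) (at 0)"
        by (auto intro!: tendsto_eq_intros)
      then show ?thesis using V by (simp add: tendsto_def)
    qed
    then have "\<forall>\<^sub>F t in at_right 0. y + t * (z - y) \<in> V"
      by (rule filter_leD[OF at_le, rotated]) simp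
    moreover have "\<forall>\<^sub>F t in at_right (0::real). 0 < t \<and> t \<le> 1"
      unfolding eventually_at_right_field by (intro exI[of _ 1]) auto
    ultimately have "\<forall>\<^sub>F t in at_right 0. (q t - q 0) / t \<le> r - h y"
    proof eventually_elim
      case (elim t)
      then have "q t - q 0 \<le> t * (r - h y)"
        using chord[of t] fh unfolding q_def by simp
      then show ?case using elim by (simp add: divide_le_eq mult.commute)
    qed
    then have "d * (z - y) \<le> r - h y"
      by (rule tendsto_upperbound[OF slope]) simp
    then show ?thesis using real fh V by simp
  qed
qed

lemma subdiff_approx_C2_near:
  fixes f :: "real \<Rightarrow> ereal"
  assumes cv: "convex_fun1 f" and pr: "proper_fun f" and "C2_near f x"
    and w: "subdiff f x = {w}" and ys: "ys \<longlonglongrightarrow> x"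
  shows "\<exists>ws. (\<forall>\<^sub>F k in sequentially. ws k \<in> subdiff f (ys k)) \<and> ws \<longlonglongrightarrow> w"
proof -
  obtain V h h' h'' where V: "open V" "x \<in> V" and fh: "\<And>z. z \<in> V \<Longrightarrow> f z = ereal (h z)"
    and h': "\<And>y. y \<in> V \<Longrightarrow> (h has_derivative blinfun_apply (h' y)) (at y)"
    and h'': "\<And>y. y \<in> V \<Longrightarrow> (h' has_derivative blinfun_apply (h'' y)) (at y)"
    using assms(3) unfolding C2_near_def C2_on_def by metis
  have sub: "h' y 1 \<in> subdiff f y" if "y \<in> V" for y
    using has_field_derivative_in_subdiff[OF cv pr V(1) that fh]
      blinfun_has_field_derivative[OF h'[OF that]] by blast
  have "isCont h' x"
    using h''[OF V(2)] by (rule has_derivative_continuous)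
  then have "(\<lambda>k. h' (ys k) 1) \<longlonglongrightarrow> h' x 1"
    using ys by (intro tendsto_intros isCont_tendsto_compose[of x h'])
  moreover have "h' x 1 = w" using sub[OF V(2)] w by simp
  moreover have "\<forall>\<^sub>F k in sequentially. ys k \<in> V"
    using ys V by (rule topological_tendstoD)
  then have "\<forall>\<^sub>F k in sequentially. h' (ys k) 1 \<in> subdiff f (ys k)"
    by eventually_elim (rule sub)
  ultimately show ?thesis by auto
qed

lemma subdiff_sep_sum_closed_graph:
  fixes G :: "'n::finite \<Rightarrow> real \<Rightarrow> ereal"
  assumes pr: "\<And>j. proper_fun (G j)" and cl: "\<And>j. closed_fun1 (G j)"
    and x: "x \<in> edom (sep_sum G)" and ys: "ys \<longlonglongrightarrow> x" and vs: "vs \<longlonglongrightarrow> v"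
    and sub: "\<And>k. vs k \<in> subdiff (sep_sum G) (ys k)"
  shows "v \<in> subdiff (sep_sum G) x"
proof -
  have "v $ j \<in> subdiff (G j) (x $ j)" for j
  proof (rule subdiff_closed_graph[OF cl pr])
    show "G j (x $ j) < \<infinity>"
      using x edom_sep_sum[of G x] pr by (auto simp: edom_def)
    show "(\<lambda>k. ys k $ j) \<longlonglongrightarrow> x $ j" "(\<lambda>k. vs k $ j) \<longlonglongrightarrow> v $ j"
      using ys vs by (auto intro: tendsto_vec_nth)
    show "vs k $ j \<in> subdiff (G j) (ys k $ j)" for k
      using sub[of k] subdiff_sep_sum[of G] pr by blast
  qed
  then show ?thesis using subdiff_sep_sum[of G] pr by blast
qed

lemma subdiff_sep_sum_approx:
  fixes G :: "'n::finite \<Rightarrow> real \<Rightarrow> ereal" and ys :: "nat \<Rightarrow> real^'n"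
  assumes pr: "\<And>j. proper_fun (G j)"
    and approx: "\<And>j. \<exists>ws. (\<forall>\<^sub>F k in sequentially. ws k \<in> subdiff (G j) (ys k $ j)) \<and> ws \<longlonglongrightarrow> v $ j"
  shows "\<exists>vs. (\<forall>\<^sub>F k in sequentially. vs k \<in> subdiff (sep_sum G) (ys k)) \<and> vs \<longlonglongrightarrow> v"
proof -
  obtain ws where ws: "\<And>j. \<forall>\<^sub>F k in sequentially. ws j k \<in> subdiff (G j) (ys k $ j)"
    and lim: "\<And>j. ws j \<longlonglongrightarrow> v $ j"
    using approx by metis
  define vs where "vs k = (\<chi> j. ws j k)" for k
  have "\<forall>\<^sub>F k in sequentially. \<forall>j. vs k $ j \<in> subdiff (G j) (ys k $ j)"
    by (rule eventually_all_finite) (simp add: vs_def ws)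
  then have "\<forall>\<^sub>F k in sequentially. vs k \<in> subdiff (sep_sum G) (ys k)"
    using subdiff_sep_sum[of G] pr by simp
  moreover have "vs \<longlonglongrightarrow> v"
    by (rule vec_tendstoI) (simp add: vs_def lim)
  ultimately show ?thesis by blast
qed

lemma affine_hull_coord_product:
  fixes D :: "'n::finite \<Rightarrow> real set"
  assumes sing: "\<And>j. j \<in> S \<Longrightarrow> D j = {c j}"
    and two: "\<And>j. j \<notin> S \<Longrightarrow> \<exists>p q. p \<in> D j \<and> q \<in> D j \<and> p \<noteq> q"
  shows "affine hull {v. \<forall>j. v $ j \<in> D j} = {v. \<forall>j\<in>S. v $ j = c j}"
    (is "affine hull ?C = ?A")
proof
  have "affine ?A"
    unfolding affine_def
  proof (intro ballI allI impI)
    fix x y :: "real^'n" and u v :: real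
    assume "x \<in> ?A" "y \<in> ?A" "u + v = 1"
    then show "u *\<^sub>R x + v *\<^sub>R y \<in> ?A" by (simp add: distrib_right[symmetric])
  qed
  moreover have "?C \<subseteq> ?A" using sing by auto
  ultimately show "affine hull ?C \<subseteq> ?A" by (rule hull_minimal[rotated])
next
  obtain p q where pq: "\<And>j. j \<notin> S \<Longrightarrow> p j \<in> D j \<and> q j \<in> D j \<and> p j \<noteq> q j"
    using two by metis
  define v0 where "v0 = (\<chi> j. if j \<in> S then c j else p j)"
  have v0C: "v0 \<in> ?C" using sing pq by (auto simp: v0_def)
  have axis: "axis j 1 \<in> span ((\<lambda>x. - v0 + x) ` ?C)" if j: "j \<notin> S" for j
  proof -
    define w where "w = (\<chi> i. if i = j then q j else v0 $ i)"
    have "w \<in> ?C" using v0C pq[OF j] by (auto simp: w_def)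
    then have "- v0 + w \<in> span ((\<lambda>x. - v0 + x) ` ?C)" by (intro span_base) auto
    moreover have "- v0 + w = (q j - p j) *\<^sub>R axis j 1"
      using j by (auto simp: vec_eq_iff w_def v0_def axis_def)
    ultimately have "(q j - p j) *\<^sub>R axis j 1 \<in> span ((\<lambda>x. - v0 + x) ` ?C)" by simp
    then have "inverse (q j - p j) *\<^sub>R ((q j - p j) *\<^sub>R axis j 1) \<in> span ((\<lambda>x. - v0 + x) ` ?C)"
      by (rule span_scale)
    then show ?thesis using pq[OF j] by simp
  qed
  show "?A \<subseteq> affine hull ?C"
  proof
    fix w assume w: "w \<in> ?A"
    have "- v0 + w = (\<Sum>j\<in>UNIV - S. (w $ j - v0 $ j) *\<^sub>R axis j 1)"
      using w by (simp add: vec_eq_iff sum_component axis_def if_distrib[of "(*) _"] sum.delta' v0_def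
          cong: if_cong)
    also have "\<dots> \<in> span ((\<lambda>x. - v0 + x) ` ?C)"
      by (intro span_sum span_scale axis) auto
    finally show "w \<in> affine hull ?C"
      unfolding affine_hull_span_gen[OF hull_inc[OF v0C]]
      by (auto intro!: image_eqI[of _ _ "- v0 + w"])
  qed
qed

lemma min_norm_elem_in:
  fixes A :: "'a::euclidean_space set"
  assumes "closed A" "convex A" "A \<noteq> {}"
  shows "min_norm_elem A \<in> A"
proof -
  have "closest_point A 0 \<in> A \<and> (\<forall>a\<in>A. norm (closest_point A 0) \<le> norm a)"
    using closest_point_exists[OF assms(1,3), of 0] by simp
  moreover have "e = closest_point A 0" if "e \<in> A \<and> (\<forall>a\<in>A. norm e \<le> norm a)" for e
    using closest_point_unique[OF assms(2,1), of e 0] that by simp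
  ultimately have "min_norm_elem A = closest_point A 0"
    unfolding min_norm_elem_def by (rule the_equality)
  then show ?thesis using closest_point_exists[OF assms(1,3)] by simp
qed

lemma Lin_subdiff_sep_sum:
  fixes G :: "'n::finite \<Rightarrow> real \<Rightarrow> ereal"
  assumes pr: "\<And>j. proper_fun (G j)" and nonempty: "subdiff (sep_sum G) x \<noteq> {}"
  shows "Lin (subdiff (sep_sum G) x) = {u. \<forall>j\<in>gen_support G x. u $ j = 0}"
proof -
  define S where "S = gen_support G x"
  define D where "D j = subdiff (G j) (x $ j)" for j
  have sub: "subdiff (sep_sum G) x = {v. \<forall>j. v $ j \<in> D j}"
    unfolding D_def using subdiff_sep_sum[of G] pr by blast
  obtain w where w: "\<And>j. w $ j \<in> D j" using nonempty unfolding sub by blast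
  have "\<forall>j\<in>S. \<exists>c. D j = {c}" unfolding S_def gen_support_def D_def by blast
  then obtain c where c: "\<And>j. j \<in> S \<Longrightarrow> D j = {c j}" by metis
  have "\<exists>p q. p \<in> D j \<and> q \<in> D j \<and> p \<noteq> q" if "j \<notin> S" for j
  proof -
    have "D j \<noteq> {w $ j}" using that unfolding S_def gen_support_def D_def by blast
    then show ?thesis using w[of j] by blast
  qed
  then have aff: "affine hull (subdiff (sep_sum G) x) = {v. \<forall>j\<in>S. v $ j = c j}"
    unfolding sub using c by (rule affine_hull_coord_product[rotated])
  define e where "e = min_norm_elem (affine hull (subdiff (sep_sum G) x))"
  have "e \<in> affine hull (subdiff (sep_sum G) x)"
    unfolding e_def using nonempty
    by (intro min_norm_elem_in) (auto intro: affine_imp_convex simp: affine_hull_eq_empty)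
  then have e: "\<forall>j\<in>S. e $ j = c j" unfolding aff by simp
  have "Lin (subdiff (sep_sum G) x) = (\<lambda>a. a - e) ` {v. \<forall>j\<in>S. v $ j = c j}"
    unfolding Lin_def e_def aff ..
  also have "\<dots> = {u. \<forall>j\<in>S. u $ j = 0}"
    using e by (auto intro: image_eqI[of _ _ "_ + e"])
  finally show ?thesis unfolding S_def .
qed

lemma orthogonal_comp_coord:
  fixes S :: "'n::finite set"
  shows "orthogonal_comp {u::real^'n. \<forall>j\<in>S. u $ j = 0} = {w. \<forall>j. j \<notin> S \<longrightarrow> w $ j = 0}"
proof safe
  fix w j assume w: "w \<in> orthogonal_comp {u::real^'n. \<forall>j\<in>S. u $ j = 0}" and j: "j \<notin> S"
  have "axis j 1 \<in> {u::real^'n. \<forall>j\<in>S. u $ j = 0}" using j by (auto simp: axis_def)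
  then have "axis j 1 \<bullet> w = 0" using w unfolding orthogonal_comp_def orthogonal_def by auto
  then show "w $ j = 0" by (simp add: inner_axis')
next
  fix w :: "real^'n" assume "\<forall>j. j \<notin> S \<longrightarrow> w $ j = 0"
  then show "w \<in> orthogonal_comp {u. \<forall>j\<in>S. u $ j = 0}"
    unfolding orthogonal_comp_def orthogonal_def inner_vec_def by (auto intro!: sum.neutral)
qed

lemma tangent_space_translated_subspace:
  fixes L :: "'a::euclidean_space set"
  assumes L: "subspace L"
  shows "tangent_space ((\<lambda>u. x + u) ` L) x = L"
proof
  show "L \<subseteq> tangent_space ((\<lambda>u. x + u) ` L) x"
  proof
    fix v assume v: "v \<in> L"
    have "((\<lambda>t. x + t *\<^sub>R v) has_vector_derivative v) (at 0)"
      by (auto intro!: derivative_eq_intros)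
    moreover have "x + t *\<^sub>R v \<in> (\<lambda>u. x + u) ` L" for t
      using v L by (simp add: subspace_scale)
    ultimately show "v \<in> tangent_space ((\<lambda>u. x + u) ` L) x"
      unfolding tangent_space_def by (intro CollectI exI[of _ "\<lambda>t. x + t *\<^sub>R v"] exI[of _ 1]) auto
  qed
next
  show "tangent_space ((\<lambda>u. x + u) ` L) x \<subseteq> L"
  proof
    fix v assume "v \<in> tangent_space ((\<lambda>u. x + u) ` L) x"
    then obtain \<gamma> e where e: "e > 0"
      and \<gamma>L: "\<And>t. t \<in> {-e<..<e} \<Longrightarrow> \<gamma> t \<in> (\<lambda>u. x + u) ` L"
      and \<gamma>': "(\<gamma> has_vector_derivative v) (at 0)"
      unfolding tangent_space_def by blast
    have "w \<bullet> v = 0" if w: "w \<in> orthogonal_comp L" for w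
    proof -
      have deriv: "((\<lambda>t. w \<bullet> \<gamma> t) has_field_derivative w \<bullet> v) (at 0)"
        using bounded_linear.has_vector_derivative[OF bounded_linear_inner_right \<gamma>']
        by (simp add: has_real_derivative_iff_has_vector_derivative)
      have const: "w \<bullet> \<gamma> t = w \<bullet> x" if t: "t \<in> ball 0 e" for t
      proof -
        obtain u where "u \<in> L" "\<gamma> t = x + u" using \<gamma>L[of t] t by (force simp: dist_real_def abs_less_iff)
        then show ?thesis using w by (simp add: orthogonal_comp_def orthogonal_def inner_add_right inner_commute)
      qed
      have "((\<lambda>t. w \<bullet> x) has_field_derivative w \<bullet> v) (at 0)"
        using e by (intro has_field_derivative_transform_within_open[OF deriv, of "ball 0 e"] const) auto
      then show ?thesis by (rule DERIV_unique) simp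
    qed
    then have "v \<in> orthogonal_comp (orthogonal_comp L)"
      unfolding orthogonal_comp_def orthogonal_def by blast
    then show "v \<in> L" using orthogonal_comp_self[OF L] by simp
  qed
qed

lemma C2_manifold_translated_subspace:
  fixes L :: "'a::euclidean_space set"
  assumes L: "subspace L" and U: "open U"
  shows "C2_manifold ((\<lambda>u. x + u) ` L \<inter> U)"
  unfolding C2_manifold_def
proof
  fix y assume y: "y \<in> (\<lambda>u. x + u) ` L \<inter> U"
  define W where "W = (\<lambda>z. z + x) -` U"
  have "open W"
    unfolding W_def by (rule continuous_open_vimage[OF U]) (intro continuous_intros)
  moreover have "C2_on U (\<lambda>z. z - x)" "C2_on W (\<lambda>z. z + x)"
    using C2_on_add[OF C2_on_id C2_on_const, of _ "- x"] C2_on_add[OF C2_on_id C2_on_const, of _ x]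
    by auto
  moreover have "(\<lambda>z. z - x) ` U = W"
    unfolding W_def by (auto intro: image_eqI[of _ _ "_ + x"])
  moreover have "(\<lambda>z. z - x) ` ((\<lambda>u. x + u) ` L \<inter> U \<inter> U) = L \<inter> W"
    unfolding W_def by (auto simp: image_image add.commute intro: image_eqI[of _ _ "x + _"])
  ultimately show "\<exists>V W (\<phi>::'a \<Rightarrow> 'a) \<psi> L'. open V \<and> y \<in> V \<and> open W \<and> subspace L' \<and>
      C2_on V \<phi> \<and> C2_on W \<psi> \<and> \<phi> ` V = W \<and> (\<forall>z\<in>V. \<psi> (\<phi> z) = z) \<and>
      \<phi> ` ((\<lambda>u. x + u) ` L \<inter> U \<inter> V) = L' \<inter> W"
    using U L y by (intro exI[of _ U] exI[of _ W] exI[of _ "\<lambda>z. z - x"] exI[of _ "\<lambda>z. z + x"] exI[of _ L])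
      auto
qed

lemma subspace_model_subspace: "subspace (model_subspace G x)"
  unfolding model_subspace_def subspace_def by auto

lemma translated_model_subspace_iff:
  "y \<in> (\<lambda>u. x + u) ` model_subspace G x \<longleftrightarrow> (\<forall>j. j \<notin> gen_support G x \<longrightarrow> y $ j = x $ j)"
  unfolding model_subspace_def by (auto intro: image_eqI[of _ _ "y - x"])

lemma sep_sum_C2_on_slice:
  fixes G :: "'n::finite \<Rightarrow> real \<Rightarrow> ereal"
  assumes pr: "\<And>j. proper_fun (G j)" and x: "x \<in> edom (sep_sum G)"
    and smooth: "\<And>j. j \<in> S \<Longrightarrow> C2_near (G j) (x $ j)"
  obtains U h where "open U" "x \<in> U" "C2_on U h"
    "\<And>z. z \<in> U \<Longrightarrow> (\<And>j. j \<notin> S \<Longrightarrow> z $ j = x $ j) \<Longrightarrow> sep_sum G z = ereal (h z)"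
proof -
  have "\<forall>j\<in>S. \<exists>V g. open V \<and> x $ j \<in> V \<and> C2_on V g \<and> (\<forall>z\<in>V. G j z = ereal (g z))"
    using smooth unfolding C2_near_def by blast
  then obtain V g where V: "\<And>j. j \<in> S \<Longrightarrow> open (V j) \<and> x $ j \<in> V j"
    and g: "\<And>j. j \<in> S \<Longrightarrow> C2_on (V j) (g j)"
    and Gg: "\<And>j z. j \<in> S \<Longrightarrow> z \<in> V j \<Longrightarrow> G j z = ereal (g j z)"
    by metis
  define U where "U = (\<Inter>j\<in>S. (\<lambda>z. z $ j) -` V j)"
  define h where "h z = (\<Sum>j\<in>S. g j (z $ j)) + (\<Sum>j\<in>-S. real_of_ereal (G j (x $ j)))" for z
  have "open U"
    unfolding U_def using V by (auto intro!: open_INT open_vimage_vec_nth)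
  moreover have "x \<in> U"
    unfolding U_def using V by auto
  moreover have "C2_on U h"
    unfolding h_def
    by (intro C2_on_add C2_on_sum C2_on_const finite)
       (auto intro: C2_on_subset[OF C2_on_vec_nth[OF g]] simp: U_def)
  moreover have "sep_sum G z = ereal (h z)" if z: "z \<in> U" "\<And>j. j \<notin> S \<Longrightarrow> z $ j = x $ j" for z
  proof -
    have "G j (z $ j) = ereal (if j \<in> S then g j (z $ j) else real_of_ereal (G j (x $ j)))" for j
      using Gg z proper_fun_finite[OF pr] x edom_sep_sum[of G x] pr by (auto simp: U_def)
    then show ?thesis
      unfolding sep_sum_def h_def by (simp add: sum.If_cases Compl_eq_Diff_UNIV)
  qed
  ultimately show thesis by (rule that)
qed

lemma pk_continuous_subdiff_sep_sum:
  fixes G :: "'n::finite \<Rightarrow> real \<Rightarrow> ereal"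
  assumes pr: "\<And>j. proper_fun (G j)" and cl: "\<And>j. closed_fun1 (G j)"
    and cv: "\<And>j. convex_fun1 (G j)" and x: "x \<in> edom (sep_sum G)"
    and smooth: "\<And>j. j \<in> gen_support G x \<Longrightarrow> C2_near (G j) (x $ j)"
  shows "pk_continuous_rel (subdiff (sep_sum G)) x ((\<lambda>u. x + u) ` model_subspace G x)"
  unfolding pk_continuous_rel_def
proof (intro conjI allI impI ballI)
  fix ys vs v
  assume "(\<forall>k. ys k \<in> (\<lambda>u. x + u) ` model_subspace G x) \<and> ys \<longlonglongrightarrow> x \<and>
    (\<forall>k. vs k \<in> subdiff (sep_sum G) (ys k)) \<and> vs \<longlonglongrightarrow> v"
  then show "v \<in> subdiff (sep_sum G) x"
    using subdiff_sep_sum_closed_graph[OF pr cl x] by blast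
next
  fix v ys
  assume v: "v \<in> subdiff (sep_sum G) x"
    and ys: "(\<forall>k. ys k \<in> (\<lambda>u. x + u) ` model_subspace G x) \<and> ys \<longlonglongrightarrow> x"
  show "\<exists>vs. (\<forall>\<^sub>F k in sequentially. vs k \<in> subdiff (sep_sum G) (ys k)) \<and> vs \<longlonglongrightarrow> v"
  proof (rule subdiff_sep_sum_approx[OF pr])
    fix j
    have vj: "v $ j \<in> subdiff (G j) (x $ j)"
      using v subdiff_sep_sum[of G] pr by blast
    show "\<exists>ws. (\<forall>\<^sub>F k in sequentially. ws k \<in> subdiff (G j) (ys k $ j)) \<and> ws \<longlonglongrightarrow> v $ j"
    proof (cases "j \<in> gen_support G x")
      case True
      then have "subdiff (G j) (x $ j) = {v $ j}"
        using vj unfolding gen_support_def by auto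
      moreover have "(\<lambda>k. ys k $ j) \<longlonglongrightarrow> x $ j"
        using ys by (auto intro: tendsto_vec_nth)
      ultimately show ?thesis
        by (rule subdiff_approx_C2_near[OF cv pr smooth[OF True]])
    next
      case False
      then have "ys k $ j = x $ j" for k
        using ys translated_model_subspace_iff by blast
      then show ?thesis using vj by (intro exI[of _ "\<lambda>_. v $ j"]) auto
    qed
  qed
qed

theorem lemma1:
  fixes G :: "'n::finite \<Rightarrow> real \<Rightarrow> ereal" and xs :: "real^'n"
  assumes "\<And>j. proper_fun (G j)"
    and "\<And>j. closed_fun1 (G j)"
    and "\<And>j. convex_fun1 (G j)"
    and "xs \<in> edom (sep_sum G)"
    and "subdiff (sep_sum G) xs \<noteq> {}"
    and "\<And>j. j \<in> gen_support G xs \<Longrightarrow> C2_near (G j) (xs $ j)"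
  shows "partly_smooth (sep_sum G) xs ((\<lambda>u. xs + u) ` model_subspace G xs)"
proof -
  define M where "M = (\<lambda>u. xs + u) ` model_subspace G xs"
  obtain U h where U: "open U" "xs \<in> U" and h: "C2_on U h"
    and gh: "\<And>z. z \<in> U \<Longrightarrow> (\<And>j. j \<notin> gen_support G xs \<Longrightarrow> z $ j = xs $ j) \<Longrightarrow>
      sep_sum G z = ereal (h z)"
    using sep_sum_C2_on_slice[OF assms(1,4,6)] by blast
  have "C2_manifold (M \<inter> U)"
    unfolding M_def using subspace_model_subspace U(1) by (rule C2_manifold_translated_subspace)
  moreover have "C2_restricted (sep_sum G) (M \<inter> U)"
    unfolding C2_restricted_def
    by (intro ballI exI[of _ U] exI[of _ h] conjI U(1) h)
       (auto simp: M_def translated_model_subspace_iff intro: gh)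
  moreover have "tangent_space M xs = orthogonal_comp (Lin (subdiff (sep_sum G) xs))"
    unfolding M_def tangent_space_translated_subspace[OF subspace_model_subspace]
      Lin_subdiff_sep_sum[OF assms(1,5)] orthogonal_comp_coord
    unfolding model_subspace_def ..
  moreover have "pk_continuous_rel (subdiff (sep_sum G)) xs M"
    unfolding M_def using assms(1-4,6) by (rule pk_continuous_subdiff_sep_sum)
  ultimately show ?thesis
    unfolding partly_smooth_def M_def[symmetric] using U by blast
qed

end
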